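(* Let \(\vec G\) be an irreflexive oriented graph. If \(\vec G\) is complete convex, then \(\chi(\vec G)=\chi_s(\vec G)\).
   Context: Oriented graphs are anti-symmetric digraphs without parallel arcs, connected, with at least two vertices; irreflexive means no loops. A homomorphism \(\phi:\vec G\to\vec H\) is a vertex map with \(\phi(u)\phi(v)\in A_{\vec H}\) for each arc \(uv\). \(\chi(\vec G)\) is the least \(k\) such that \(\vec G\to\vec T\) for some (loopless) tournament \(\vec T\) on \(k\) vertices. \(\chi_s(\vec G)\) (simple chromatic number) is the least \(k\) such that there is a non-trivial homomorphism of \(\vec G\) to some reflexive tournament (a tournament with a loop at every vertex) on \(k\) vertices, where a homomorphism is trivial if every arc is mapped to the same loop. A \(2\)-dipath \(u,v,w\) with centre \(v\): \(uv,vw\) arcs, \(u\ne v\ne w\). A vertex set \(S\) is convex if no vertex outside \(S\) is the centre of a \(2\)-dipath with ends in \(S\); \(conv(S)\) is the smallest convex superset; \(\vec G\) is complete convex if \(conv(\{u,v\})=V_G\) for every arc \(uv\). *)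

theory Defs
  imports "Graph_Theory.Digraph_Component" "HOL-Library.Extended_Nat"
begin

(* Loops are allowed, so that irreflexivity remains a separate hypothesis.
   Connectedness is that of the underlying undirected graph, as in Digraph_Component. *)
locale oriented_graph = pair_wf_digraph G for G :: "'a pair_pre_digraph" +
  assumes antisym_arcs: "antisym (parcs G)"
    and connected: "Digraph_Component.connected (with_proj G)"
    and two_verts: "\<exists>u \<in> pverts G. \<exists>v \<in> pverts G. u \<noteq> v"

definition digraph_hom ::
  "'a pair_pre_digraph \<Rightarrow> 'b pair_pre_digraph \<Rightarrow> ('a \<Rightarrow> 'b) \<Rightarrow> bool" where
  "digraph_hom G H \<phi> \<longleftrightarrow>
     (\<forall>v \<in> pverts G. \<phi> v \<in> pverts H) \<and> (\<forall>(u, v) \<in> parcs G. (\<phi> u, \<phi> v) \<in> parcs H)"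

definition trivial_hom ::
  "'a pair_pre_digraph \<Rightarrow> 'b pair_pre_digraph \<Rightarrow> ('a \<Rightarrow> 'b) \<Rightarrow> bool" where
  "trivial_hom G H \<phi> \<longleftrightarrow>
     (\<exists>x. (x, x) \<in> parcs H \<and> (\<forall>(u, v) \<in> parcs G. (\<phi> u, \<phi> v) = (x, x)))"

definition tournament :: "'a pair_pre_digraph \<Rightarrow> bool" where
  "tournament T \<longleftrightarrow>
     pair_loopfree_digraph T \<and> antisym (parcs T) \<and> total_on (pverts T) (parcs T)"

definition reflexive_tournament :: "'a pair_pre_digraph \<Rightarrow> bool" where
  "reflexive_tournament T \<longleftrightarrow>
     pair_wf_digraph T \<and> refl_on (pverts T) (parcs T) \<and>
     antisym (parcs T) \<and> total_on (pverts T) (parcs T)"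

(* Every tournament on k vertices has an isomorphic copy with vertices of type nat.
   The infimum of a nonempty set of enat is its minimum, and it is \<infinity> for the empty set;
   so no finiteness of G is needed, and an infinite value means that no k exists. *)
definition chromatic_number :: "'a pair_pre_digraph \<Rightarrow> enat" where
  "chromatic_number G =
     Inf {enat k | k. \<exists>(T :: nat pair_pre_digraph) \<phi>.
       tournament T \<and> finite (pverts T) \<and> card (pverts T) = k \<and> digraph_hom G T \<phi>}"

definition simple_chromatic_number :: "'a pair_pre_digraph \<Rightarrow> enat" where
  "simple_chromatic_number G =
     Inf {enat k | k. \<exists>(T :: nat pair_pre_digraph) \<phi>.
       reflexive_tournament T \<and> finite (pverts T) \<and> card (pverts T) = k \<and>
       digraph_hom G T \<phi> \<and> \<not> trivial_hom G T \<phi>}"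

definition two_dipath :: "'a pair_pre_digraph \<Rightarrow> 'a \<Rightarrow> 'a \<Rightarrow> 'a \<Rightarrow> bool" where
  "two_dipath G u v w \<longleftrightarrow> (u, v) \<in> parcs G \<and> (v, w) \<in> parcs G \<and> u \<noteq> v \<and> v \<noteq> w"

definition convex_verts :: "'a pair_pre_digraph \<Rightarrow> 'a set \<Rightarrow> bool" where
  "convex_verts G S \<longleftrightarrow>
     S \<subseteq> pverts G \<and> \<not> (\<exists>v \<in> pverts G - S. \<exists>u \<in> S. \<exists>w \<in> S. two_dipath G u v w)"

definition conv :: "'a pair_pre_digraph \<Rightarrow> 'a set \<Rightarrow> 'a set" where
  "conv G S = convex_verts G hull S"

lemma convex_verts_Inter:
  assumes "C \<in> \<C>" and "\<And>D. D \<in> \<C> \<Longrightarrow> convex_verts G D"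
  shows "convex_verts G (\<Inter>\<C>)"
  unfolding convex_verts_def
proof (intro conjI notI)
  show "\<Inter>\<C> \<subseteq> pverts G"
    using assms by (auto simp: convex_verts_def)
next
  assume "\<exists>v \<in> pverts G - \<Inter>\<C>. \<exists>u \<in> \<Inter>\<C>. \<exists>w \<in> \<Inter>\<C>. two_dipath G u v w"
  then obtain u v w where uvw: "v \<in> pverts G" "v \<notin> \<Inter>\<C>"
      "u \<in> \<Inter>\<C>" "w \<in> \<Inter>\<C>" "two_dipath G u v w"
    by (elim bexE DiffE)
  then obtain D where D: "D \<in> \<C>" "v \<notin> D"
    by auto
  then have "u \<in> D" "w \<in> D"
    using uvw by auto
  with uvw D assms(2)[OF D(1)] show False
    unfolding convex_verts_def by auto
qed

lemma convex_verts_conv: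
  assumes "S \<subseteq> pverts G"
  shows "convex_verts G (conv G S)"
  unfolding conv_def hull_def
proof (rule convex_verts_Inter)
  show "pverts G \<in> {t. convex_verts G t \<and> S \<subseteq> t}"
    using assms by (simp add: convex_verts_def)
qed simp

lemma subset_conv: "S \<subseteq> conv G S"
  unfolding conv_def by (rule hull_subset)

lemma conv_minimal: "convex_verts G C \<Longrightarrow> S \<subseteq> C \<Longrightarrow> conv G S \<subseteq> C"
  unfolding conv_def by (rule hull_minimal)

definition complete_convex :: "'a pair_pre_digraph \<Rightarrow> bool" where
  "complete_convex G \<longleftrightarrow> (\<forall>(u, v) \<in> parcs G. conv G {u, v} = pverts G)"

end

theory Submission
  imports Defs
begin

text \<open>
  Adding all loops to a tournament, or deleting them, translates between the two kinds of targets,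
  so the two sets of admissible sizes coincide. The point is that a homomorphism to a reflexive
  tournament has convex fibres, since by antisymmetry the centre of a 2-dipath whose ends are
  mapped to \<open>x\<close> is mapped to \<open>x\<close> as well. In a complete convex graph a fibre containing both ends
  of an arc is therefore the whole vertex set, and so a homomorphism that uses a loop is trivial.
\<close>

definition add_loops :: "'a pair_pre_digraph \<Rightarrow> 'a pair_pre_digraph" where
  "add_loops T = \<lparr>pverts = pverts T, parcs = parcs T \<union> Id_on (pverts T)\<rparr>"

definition delete_loops :: "'a pair_pre_digraph \<Rightarrow> 'a pair_pre_digraph" where
  "delete_loops T = \<lparr>pverts = pverts T, parcs = parcs T - Id\<rparr>"

lemma pverts_add_loops [simp]: "pverts (add_loops T) = pverts T"
  and parcs_add_loops [simp]: "parcs (add_loops T) = parcs T \<union> Id_on (pverts T)"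
  by (simp_all add: add_loops_def)

lemma pverts_delete_loops [simp]: "pverts (delete_loops T) = pverts T"
  and parcs_delete_loops [simp]: "parcs (delete_loops T) = parcs T - Id"
  by (simp_all add: delete_loops_def)

lemma reflexive_tournament_add_loops:
  assumes "tournament T"
  shows "reflexive_tournament (add_loops T)"
proof -
  interpret pair_loopfree_digraph T
    using assms by (simp add: tournament_def)
  have "pair_wf_digraph (add_loops T)"
    by unfold_locales (auto dest: in_arcsD1 in_arcsD2)
  moreover have "refl_on (pverts T) (parcs T \<union> Id_on (pverts T))"
    by (auto simp: refl_on_def dest: in_arcsD1 in_arcsD2)
  moreover have "antisym (parcs T \<union> Id_on (pverts T))"
    using assms by (auto simp: tournament_def antisym_def)
  ultimately show ?thesis
    using assms by (auto simp: reflexive_tournament_def tournament_def total_on_def)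
qed

lemma tournament_delete_loops:
  assumes "reflexive_tournament T"
  shows "tournament (delete_loops T)"
proof -
  interpret pair_wf_digraph T
    using assms by (simp add: reflexive_tournament_def)
  have "pair_loopfree_digraph (delete_loops T)"
    by unfold_locales (auto dest: in_arcsD1 in_arcsD2)
  then show ?thesis
    using assms by (auto simp: reflexive_tournament_def tournament_def total_on_def antisym_def)
qed

lemma digraph_hom_arcD: "digraph_hom G H \<phi> \<Longrightarrow> (u, v) \<in> parcs G \<Longrightarrow> (\<phi> u, \<phi> v) \<in> parcs H"
  by (auto simp: digraph_hom_def)

lemma digraph_hom_add_loops: "digraph_hom G T \<phi> \<Longrightarrow> digraph_hom G (add_loops T) \<phi>"
  by (auto simp: digraph_hom_def)

lemma digraph_hom_delete_loops:
  assumes "digraph_hom G T \<phi>" and "\<And>u v. (u, v) \<in> parcs G \<Longrightarrow> \<phi> u \<noteq> \<phi> v"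
  shows "digraph_hom G (delete_loops T) \<phi>"
  using assms by (fastforce simp: digraph_hom_def)

text \<open>Serves to exclude vacuous triviality: without arcs, every homomorphism to a target with
  a loop would count as trivial.\<close>

lemma (in oriented_graph) ex_arc: "\<exists>u v. (u, v) \<in> parcs G"
proof (rule ccontr)
  assume no_arc: "\<not> ?thesis"
  obtain u v where uv: "u \<in> pverts G" "v \<in> pverts G" "u \<noteq> v"
    using two_verts by blast
  have "u \<rightarrow>\<^sup>*\<^bsub>with_proj (mk_symmetric (with_proj G))\<^esub> v"
    using connected uv by (auto simp: connected_def strongly_connected_def)
  then show False
    \<comment> \<open>As \<open>u\<close> and \<open>v\<close> differ, a walk between them has a
      first arc. It lies in the symmetric closure, so it or its reversal is an arc of
      \<open>G\<close>.\<close>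
    using uv(3) no_arc
    by (cases rule: pre_digraph.converse_reachable_cases) (auto simp: parcs_mk_symmetric)
qed

lemma convex_verts_fibre:
  assumes "reflexive_tournament T" and "digraph_hom G T \<phi>"
  shows "convex_verts G {v \<in> pverts G. \<phi> v = x}"
proof -
  have "\<phi> v = x" if "(u, v) \<in> parcs G" "(v, w) \<in> parcs G" "\<phi> u = x" "\<phi> w = x" for u v w
    using that assms(1) digraph_hom_arcD[OF assms(2)]
    by (metis antisymD reflexive_tournament_def)
  then show ?thesis
    by (fastforce simp: convex_verts_def two_dipath_def)
qed

text \<open>Used contrapositively: a non-trivial homomorphism identifies the ends of no arc, so it
  survives the deletion of the loops of \<open>T\<close>.\<close>

lemma trivial_hom_if_loop:
  assumes "pair_wf_digraph G" "complete_convex G" "reflexive_tournament T" "digraph_hom G T \<phi>"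
    and uv: "(u, v) \<in> parcs G" "\<phi> u = \<phi> v"
  shows "trivial_hom G T \<phi>"
proof -
  interpret pair_wf_digraph G by fact
  have "conv G {u, v} \<subseteq> {w \<in> pverts G. \<phi> w = \<phi> v}"
    using uv by (intro conv_minimal convex_verts_fibre[OF assms(3,4)])
      (auto dest: in_arcsD1 in_arcsD2)
  then have "\<phi> w = \<phi> v" if "w \<in> pverts G" for w
    using assms(2) uv(1) that by (fastforce simp: complete_convex_def)
  \<comment> \<open>The loop that witnesses triviality is the image of the arc from \<open>u\<close>
    to \<open>v\<close> itself.\<close>
  moreover have "(\<phi> v, \<phi> v) \<in> parcs T"
    using digraph_hom_arcD[OF assms(4) uv(1)] uv(2) by simp
  ultimately show ?thesis
    by (auto simp: trivial_hom_def intro!: exI[of _ "\<phi> v"] dest: in_arcsD1 in_arcsD2)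
qed

text \<open>As \<open>T\<close> is loopless, an arc of \<open>G\<close> has an image with distinct
  ends, and adding loops to the target does not change that image.\<close>

lemma (in oriented_graph) simple_hom_add_loops:
  assumes "tournament T" "digraph_hom G T \<phi>"
  shows "\<not> trivial_hom G (add_loops T) \<phi>"
proof -
  interpret T: pair_loopfree_digraph T
    using assms by (simp add: tournament_def)
  obtain u v where uv: "(u, v) \<in> parcs G"
    using ex_arc by blast
  then have "\<phi> u \<noteq> \<phi> v"
    using digraph_hom_arcD[OF assms(2) uv] T.no_loops' by metis
  with uv show ?thesis
    by (fastforce simp: trivial_hom_def)
qed

theorem theorem34:
  fixes G :: "'a pair_pre_digraph"
  assumes "oriented_graph G"
    and "pair_loopfree_digraph G"
    and "complete_convex G"
  shows "chromatic_number G = simple_chromatic_number G"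
proof -
  interpret oriented_graph G by fact
  \<comment> \<open>The two infima are compared size by size. Both directions keep the map and the
    vertex set of the target, hence also \<open>k\<close>.\<close>
  have "(\<exists>(T :: nat pair_pre_digraph) \<phi>.
          tournament T \<and> finite (pverts T) \<and> card (pverts T) = k \<and> digraph_hom G T \<phi>) \<longleftrightarrow>
        (\<exists>(T :: nat pair_pre_digraph) \<phi>.
          reflexive_tournament T \<and> finite (pverts T) \<and> card (pverts T) = k \<and>
          digraph_hom G T \<phi> \<and> \<not> trivial_hom G T \<phi>)" (is "?L \<longleftrightarrow> ?R") for k
  proof
    assume ?L
    then show ?R
      using reflexive_tournament_add_loops digraph_hom_add_loops simple_hom_add_loops
        pverts_add_loops by metis
  next
    assume ?R
    then obtain T :: "nat pair_pre_digraph" and \<phi>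
      where T: "reflexive_tournament T" "finite (pverts T)" "card (pverts T) = k"
        and \<phi>: "digraph_hom G T \<phi>" "\<not> trivial_hom G T \<phi>"
      by blast
    \<comment> \<open>Complete convexity enters here: an arc mapped to a loop would make the map
      trivial.\<close>
    have "digraph_hom G (delete_loops T) \<phi>"
      using trivial_hom_if_loop[OF pair_wf_digraph_axioms assms(3) T(1)] \<phi>
      by (blast intro: digraph_hom_delete_loops)
    with T show ?L
      using tournament_delete_loops pverts_delete_loops by metis
  qed
  then show ?thesis
    by (simp add: chromatic_number_def simple_chromatic_number_def)
qed

end
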